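(* Let $r$ be a prime number, $m$ a positive integer, $N>1$ an integer with $N\mid (r^m-1)$. Let $q$ be a power of a prime $p$ with $\gcd(p,r)=1$, $N\mid (q-1)$ and $4\mid (q-1)$. Let $\beta$ be the fixed primitive element of $\mathbb{F}_q$, put $v=\beta^{(q-1)/4}$, let $\varphi:\mathbb{F}_{r^m}^*\to\mathbb{F}_q^*$ be the homomorphism of order $N$ defined in the context, let $P$ be the $r^m\times r^m$ matrix over $\mathbb{F}_q$ defined in the context with diagonal value $v$, and let $C=C_{(\varphi,\beta^{(q-1)/4})}$ be the linear code over $\mathbb{F}_q$ with generator matrix $[I_{r^m},P]$. If $\frac{r^m-1}{N}$ is even and $2v+g(\varphi,\chi_a)\neq 0$ for all $a\in\mathbb{F}_{r^m}^*$, then $C$ is a $[2r^m,r^m]$ linear code over $\mathbb{F}_q$ with one-dimensional hull.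
   Context: Fix a primitive element $\alpha$ of $\mathbb{F}_{r^m}$ and a primitive element $\beta$ of $\mathbb{F}_q$, and put $u=\beta^{(q-1)/N}$. Define $\varphi:\mathbb{F}_{r^m}^*\to\mathbb{F}_q^*$ by $\varphi(\alpha^k)=u^k$ for $0\le k\le r^m-2$; this is a group homomorphism of order $N$. Let $t$ be a positive integer with $r\mid (q^t-1)$ (it exists since $\gcd(p,r)=1$), let $\gamma$ be a fixed primitive element of $\mathbb{F}_{q^t}$ and $\zeta=\gamma^{(q^t-1)/r}$. For $a\in\mathbb{F}_{r^m}$ define $\chi_a:\mathbb{F}_{r^m}\to\overline{\mathbb{F}}_q^*$ by $\chi_a(x)=\zeta^{\mathrm{Tr}(ax)}$, where $\mathrm{Tr}$ is the trace from $\mathbb{F}_{r^m}$ to $\mathbb{F}_r$. Put $g(\varphi,\chi_a)=\sum_{x\in\mathbb{F}_{r^m}^*}\varphi(x)\chi_a(x)\in\overline{\mathbb{F}}_q$. Enumerate $\mathbb{F}_{r^m}=\{x_i:1\le i\le r^m\}$. For $v\in\mathbb{F}_q$, $P=(p_{ij})$ is the $r^m\times r^m$ matrix over $\mathbb{F}_q$ with $p_{ij}=\varphi(x_j-x_i)$ for $i\ne j$ and $p_{ii}=v$. $C_{(\varphi,v)}$ denotes the linear code over $\mathbb{F}_q$ generated by the rows of $[I_{r^m},P]$. An $[n,k]$ linear code over $\mathbb{F}_q$ is a $k$-dimensional subspace of $\mathbb{F}_q^n$; $C^\perp$ is its dual for the inner product $\langle u,w\rangle=\sum_i u_iw_i$.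 The hull of $C$ is $\mathrm{Hull}(C)=C\cap C^\perp$; "one-dimensional hull" means $\dim_{\mathbb{F}_q}\mathrm{Hull}(C)=1$. *)

theory Defs
  imports
    "HOL-Library.Cardinality"
    "HOL-Algebra.Algebraic_Closure_Type"
    "Jordan_Normal_Form.VS_Connect"
begin

text \<open>
  The finite fields are types of class \<^class>\<open>finite_field\<close>; the algebraic closure
  of a field type 'f is the library type 'f alg_closure, with embedding \<^const>\<open>to_ac\<close>.
  Vectors and matrices are indexed from 0.
\<close>

section \<open>Primitive elements and characters\<close>

definition primitive_element :: "'a::field set \<Rightarrow> 'a \<Rightarrow> bool" where
  "primitive_element K g \<longleftrightarrow> K - {0} = range (\<lambda>k::nat. g ^ k)"

text \<open>The subfield of order n (a power of the characteristic) of the algebraic closure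
  consists of the roots of $X^n - X$.\<close>

definition ac_subfield :: "nat \<Rightarrow> 'f::field alg_closure set" where
  "ac_subfield n = {x. x ^ n = x}"

text \<open>The map sending \<open>\<alpha> ^ k\<close> to \<open>u ^ k\<close> for \<open>0 \<le> k \<le> CARD('k) - 2\<close>. For primitive
  \<open>\<alpha>\<close> these powers run exactly once through the nonzero elements; the value at 0 is
  unspecified and never used.\<close>

definition mult_char :: "'k::finite_field \<Rightarrow> 'f::field \<Rightarrow> 'k \<Rightarrow> 'f" where
  "mult_char \<alpha> u x = u ^ (THE k. k \<le> CARD('k) - 2 \<and> \<alpha> ^ k = x)"

definition field_trace :: "nat \<Rightarrow> nat \<Rightarrow> 'k::field \<Rightarrow> 'k" where
  "field_trace r m x = (\<Sum>i<m. x ^ (r ^ i))"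

text \<open>The trace takes values in the prime field, whose elements are the \<open>of_nat k\<close> with
  \<open>k < r\<close>; this integer \<open>k\<close> is the exponent of \<open>\<zeta>\<close>.\<close>

definition additive_char ::
    "nat \<Rightarrow> nat \<Rightarrow> 'l::field \<Rightarrow> 'k::finite_field \<Rightarrow> 'k \<Rightarrow> 'l" where
  "additive_char r m \<zeta> a x = \<zeta> ^ (THE k. k < r \<and> of_nat k = field_trace r m (a * x))"

definition gauss_sum ::
    "('k::finite_field \<Rightarrow> 'f::field) \<Rightarrow> ('k \<Rightarrow> 'f alg_closure) \<Rightarrow> 'f alg_closure" where
  "gauss_sum \<phi> \<chi> = (\<Sum>x\<in>UNIV - {0}. to_ac (\<phi> x) * \<chi> x)"

section \<open>Linear codes\<close>

definition code_dim :: "nat \<Rightarrow> 'a::field vec set \<Rightarrow> nat" where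
  "code_dim n C = vectorspace.dim class_ring ((module_vec TYPE('a) n)\<lparr>carrier := C\<rparr>)"

definition linear_code :: "nat \<Rightarrow> nat \<Rightarrow> 'a::field vec set \<Rightarrow> bool" where
  "linear_code n k C \<longleftrightarrow>
     VectorSpace.subspace class_ring C (module_vec TYPE('a) n) \<and> code_dim n C = k"

definition dual_code :: "nat \<Rightarrow> 'a::field vec set \<Rightarrow> 'a vec set" where
  "dual_code n C = vec_module.orthogonal_complement n C"

definition code_hull :: "nat \<Rightarrow> 'a::field vec set \<Rightarrow> 'a vec set" where
  "code_hull n C = C \<inter> dual_code n C"

section \<open>The matrix P and the code generated by [I, P]\<close>

text \<open>Here x enumerates the field as \<open>x 0, \<dots>, x (n - 1)\<close>.\<close>

definition char_matrix ::
    "nat \<Rightarrow> (nat \<Rightarrow> 'k::finite_field) \<Rightarrow> ('k \<Rightarrow> 'f::field) \<Rightarrow> 'f \<Rightarrow> 'f mat" where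
  "char_matrix n x \<phi> v = mat n n (\<lambda>(i, j). if i = j then v else \<phi> (x j - x i))"

definition append_columns :: "'a::zero mat \<Rightarrow> 'a mat \<Rightarrow> 'a mat" where
  "append_columns A B = four_block_mat A B (0\<^sub>m 0 (dim_col A)) (0\<^sub>m 0 (dim_col B))"

definition char_code ::
    "nat \<Rightarrow> (nat \<Rightarrow> 'k::finite_field) \<Rightarrow> ('k \<Rightarrow> 'f::field) \<Rightarrow> 'f \<Rightarrow> 'f vec set" where
  "char_code n x \<phi> v =
     vec_space.row_space (2 * n) (append_columns (1\<^sub>m n) (char_matrix n x \<phi> v))"

end

theory Submission
  imports Defs "HOL-Number_Theory.Residues" "Jordan_Normal_Form.DL_Rank"
begin

text \<open>Write \<open>P = v + Q\<close>, where \<open>Q\<close> is the convolution operator \<open>f \<mapsto> (\<Sum>b. \<psi> (b - a) f b)\<close> with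
  \<open>\<psi>\<close> the extension of \<open>\<phi>\<close> by \<open>0\<close>. Since \<open>(r ^ m - 1) / N\<close> is even, \<open>\<phi> (-1) = 1\<close>, so \<open>P\<close> is
  symmetric, and the hull of the code consists of the vectors \<open>(y, P y)\<close> with \<open>y + P\<^sup>2 y = 0\<close>. As
  \<open>v\<^sup>2 = -1\<close>, this says \<open>(2 v + Q) (Q y) = 0\<close>. The additive characters diagonalise \<open>2 v + Q\<close>
  with eigenvalues \<open>2 v\<close> and \<open>2 v + g(\<phi>, \<chi>\<^sub>a)\<close>, all nonzero, so \<open>Q y = 0\<close>. Convolving with the
  inverse character shows that the kernel of \<open>Q\<close> consists of the constant vectors.\<close>

no_notation fps_nth (infixl \<open>$\<close> 75)

section \<open>Codes with a systematic generator matrix\<close>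

text \<open>Injectivity of the transpose on coefficient vectors is linear independence of the rows.
  Independence is stated for the set of columns of \<open>A\<^sup>T\<close>, so repeated columns
  have to be excluded separately.\<close>

lemma linear_code_row_space:
  fixes A :: "'a::field mat"
  assumes A: "A \<in> carrier_mat k n"
    and inj: "\<And>y. y \<in> carrier_vec k \<Longrightarrow> A\<^sup>T *\<^sub>v y = 0\<^sub>v n \<Longrightarrow> y = 0\<^sub>v k"
  shows "linear_code n k (vec_space.row_space n A)"
proof -
  interpret vec_space "TYPE('a)" n .
  have At: "A\<^sup>T \<in> carrier_mat n k" using A by simp
  have dist: "distinct (cols A\<^sup>T)"
  proof (rule ccontr)
    assume "\<not> distinct (cols A\<^sup>T)"
    then obtain i j where ij: "i < k" "j < k" "i \<noteq> j" and eq: "col A\<^sup>T i = col A\<^sup>T j"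
      using At by (auto simp: distinct_conv_nth)
    \<comment> \<open>If columns \<open>i\<close> and \<open>j\<close> coincide, this difference of
      unit vectors is a nonzero kernel vector.\<close>
    define y where "y = (unit_vec k i - unit_vec k j :: 'a vec)"
    have "A\<^sup>T *\<^sub>v y = A\<^sup>T *\<^sub>v unit_vec k i - A\<^sup>T *\<^sub>v unit_vec k j"
      unfolding y_def by (rule mult_minus_distrib_mat_vec[OF At]) auto
    also have "\<dots> = col A\<^sup>T i - col A\<^sup>T j"
      using ij At by (auto intro!: eq_vecI arg_cong2[where f="(-)"])
    also have "\<dots> = 0\<^sub>v n" using eq At by auto
    finally have "y = 0\<^sub>v k" by (intro inj) (auto simp: y_def)
    then have "y $ i = 0" using ij by simp
    then show False using ij by (simp add: y_def)
  qed
  have indpt: "lin_indpt (set (cols A\<^sup>T))"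
    using lin_depE[OF At _ dist] inj by metis
  have "rank A\<^sup>T = k" by (rule lin_indpt_full_rank[OF At dist indpt])
  then have "code_dim n (row_space A) = k"
    by (simp add: code_dim_def rank_def row_space_def)
  moreover have "VectorSpace.subspace class_ring (row_space A) V"
    unfolding row_space_def by (rule span_is_subspace) (use A rows_carrier[of A] in auto)
  ultimately show ?thesis by (simp add: linear_code_def)
qed

text \<open>Multiplication by the transposed generator matrix encodes \<open>y\<close> as
  \<open>(y, P\<^sup>T y)\<close>. The identity block returns \<open>y\<close> itself, so the
  encoding is injective.\<close>

lemma row_space_append_columns_one:
  fixes P :: "'a::field mat"
  assumes P: "P \<in> carrier_mat n n"
  shows "vec_space.row_space (2 * n) (append_columns (1\<^sub>m n) P)
    = (\<lambda>y. y @\<^sub>v (P\<^sup>T *\<^sub>v y)) ` carrier_vec n"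
    and "linear_code (2 * n) n (vec_space.row_space (2 * n) (append_columns (1\<^sub>m n) P))"
proof -
  let ?G = "append_columns (1\<^sub>m n) P"
  have G: "?G \<in> carrier_mat n (2 * n)"
    using P unfolding append_columns_def by (auto intro!: carrier_matI)
  have mult: "?G\<^sup>T *\<^sub>v y = y @\<^sub>v (P\<^sup>T *\<^sub>v y)" if y: "y \<in> carrier_vec n" for y
  proof (rule eq_vecI)
    fix i assume "i < dim_vec (y @\<^sub>v (P\<^sup>T *\<^sub>v y))"
    then have i: "i < 2 * n" using P y by simp
    have "(?G\<^sup>T *\<^sub>v y) $ i = col ?G i \<bullet> y" using G i by simp
    also have "col ?G i = (if i < n then unit_vec n i else col P (i - n))"
      using P i by (auto simp: append_columns_def)
    also have "\<dots> \<bullet> y = (y @\<^sub>v (P\<^sup>T *\<^sub>v y)) $ i"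
      using P y i by auto
    finally show "(?G\<^sup>T *\<^sub>v y) $ i = (y @\<^sub>v (P\<^sup>T *\<^sub>v y)) $ i" .
  qed (use G P y in auto)
  interpret vec_space "TYPE('a)" "2 * n" .
  show "row_space ?G = (\<lambda>y. y @\<^sub>v (P\<^sup>T *\<^sub>v y)) ` carrier_vec n"
  proof -
    have "y @\<^sub>v (P\<^sup>T *\<^sub>v y) \<in> carrier_vec (2 * n)" if "y \<in> carrier_vec n" for y
      using append_carrier_vec[OF that, of "P\<^sup>T *\<^sub>v y" n] that P by (simp add: mult_2)
    then show ?thesis unfolding row_space_eq[OF G] using G by (auto simp: mult image_def)
  qed
  show "linear_code (2 * n) n (row_space ?G)"
  proof (rule linear_code_row_space[OF G])
    fix y assume y: "y \<in> carrier_vec n" and "?G\<^sup>T *\<^sub>v y = 0\<^sub>v (2 * n)"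
    then have eq: "y @\<^sub>v (P\<^sup>T *\<^sub>v y) = 0\<^sub>v (2 * n)" by (simp add: mult)
    show "y = 0\<^sub>v n"
    proof (rule eq_vecI)
      fix i assume "i < dim_vec (0\<^sub>v n)"
      then show "y $ i = 0\<^sub>v n $ i" using y P arg_cong[OF eq, of "\<lambda>w. w $ i"] by simp
    qed (use y in auto)
  qed
qed

text \<open>Moving \<open>P\<^sup>T\<close> across the inner product turns the product of the
  codewords of \<open>y\<close> and \<open>z\<close> into
  \<open>(y + P P\<^sup>T y) \<bullet> z\<close>. Nondegeneracy then leaves a kernel condition on
  the message \<open>y\<close>.\<close>

lemma code_hull_systematic:
  fixes P :: "'a::field mat"
  assumes P: "P \<in> carrier_mat n n"
  shows "code_hull (2 * n) ((\<lambda>y. y @\<^sub>v (P\<^sup>T *\<^sub>v y)) ` carrier_vec n)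
    = (\<lambda>y. y @\<^sub>v (P\<^sup>T *\<^sub>v y)) ` {y \<in> carrier_vec n. y + P *\<^sub>v (P\<^sup>T *\<^sub>v y) = 0\<^sub>v n}"
proof -
  let ?enc = "\<lambda>y. y @\<^sub>v (P\<^sup>T *\<^sub>v y)"
  have inner: "(y @\<^sub>v (P\<^sup>T *\<^sub>v y)) \<bullet> (z @\<^sub>v (P\<^sup>T *\<^sub>v z)) = (y + P *\<^sub>v (P\<^sup>T *\<^sub>v y)) \<bullet> z"
    if y: "y \<in> carrier_vec n" and z: "z \<in> carrier_vec n" for y z
  proof -
    have Py: "P\<^sup>T *\<^sub>v y \<in> carrier_vec n" and Pz: "P\<^sup>T *\<^sub>v z \<in> carrier_vec n" using P y z by auto
    have "(P\<^sup>T *\<^sub>v y) \<bullet> (P\<^sup>T *\<^sub>v z) = (P *\<^sub>v (P\<^sup>T *\<^sub>v y)) \<bullet> z"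
      using transpose_vec_mult_scalar[OF P Py z] comm_scalar_prod[OF Py Pz]
        comm_scalar_prod[OF z mult_mat_vec_carrier[OF P Py]] by simp
    then show ?thesis
      unfolding scalar_prod_append[OF y Py z Pz]
        add_scalar_prod_distrib[OF y mult_mat_vec_carrier[OF P Py] z] by simp
  qed
  have nondeg: "w = 0\<^sub>v n" if w: "w \<in> carrier_vec n" and "\<And>z. z \<in> carrier_vec n \<Longrightarrow> w \<bullet> z = 0" for w :: "'a vec"
  proof (rule eq_vecI)
    fix i assume i: "i < dim_vec (0\<^sub>v n)"
    then show "w $ i = 0\<^sub>v n $ i" using that(2)[of "unit_vec n i"] w by simp
  qed (use w in auto)
  have "(\<forall>z\<in>carrier_vec n. (y @\<^sub>v (P\<^sup>T *\<^sub>v y)) \<bullet> (z @\<^sub>v (P\<^sup>T *\<^sub>v z)) = 0)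
      \<longleftrightarrow> y + P *\<^sub>v (P\<^sup>T *\<^sub>v y) = 0\<^sub>v n" if y: "y \<in> carrier_vec n" for y
  proof -
    have "y + P *\<^sub>v (P\<^sup>T *\<^sub>v y) \<in> carrier_vec n" using P y by auto
    then show ?thesis using y nondeg by (auto simp: inner)
  qed
  moreover have "?enc y \<in> carrier_vec (2 * n)" if "y \<in> carrier_vec n" for y
    using append_carrier_vec[OF that, of "P\<^sup>T *\<^sub>v y" n] that P by (simp add: mult_2)
  ultimately have "?enc y \<in> code_hull (2 * n) (?enc ` carrier_vec n)
      \<longleftrightarrow> y + P *\<^sub>v (P\<^sup>T *\<^sub>v y) = 0\<^sub>v n" if "y \<in> carrier_vec n" for y
    using that unfolding code_hull_def dual_code_def vec_module.orthogonal_complement_def by blast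
  moreover have "code_hull (2 * n) (?enc ` carrier_vec n) \<subseteq> ?enc ` carrier_vec n"
    by (simp add: code_hull_def)
  ultimately show ?thesis by blast
qed

text \<open>The line is the row space of the one-row matrix with row \<open>w\<close>.\<close>

lemma code_dim_line:
  fixes w :: "'a::field vec"
  assumes w: "w \<in> carrier_vec n" "w \<noteq> 0\<^sub>v n"
  shows "code_dim n (range (\<lambda>c. c \<cdot>\<^sub>v w)) = 1"
proof -
  interpret vec_space "TYPE('a)" n .
  let ?A = "mat_of_row w"
  have A: "?A \<in> carrier_mat 1 n" using w by simp
  have mult: "?A\<^sup>T *\<^sub>v y = (y $ 0) \<cdot>\<^sub>v w" if "y \<in> carrier_vec 1" for y
    using that w by (intro eq_vecI) (auto simp: scalar_prod_def mult.commute)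
  have "row_space ?A = range (\<lambda>c. c \<cdot>\<^sub>v w)"
  proof -
    have "row_space ?A = {u \<in> carrier_vec n. \<exists>y\<in>carrier_vec 1. (y $ 0) \<cdot>\<^sub>v w = u}"
      unfolding row_space_eq[OF A] using A by (auto simp: mult)
    moreover have "\<exists>y\<in>carrier_vec 1. y $ 0 = c" for c :: 'a
      by (rule bexI[of _ "vec 1 (\<lambda>_. c)"]) auto
    ultimately show ?thesis using w by (auto simp: image_def) metis
  qed
  moreover have "linear_code n 1 (row_space ?A)"
  proof (rule linear_code_row_space[OF A])
    fix y assume y: "y \<in> carrier_vec 1" and "?A\<^sup>T *\<^sub>v y = 0\<^sub>v n"
    then have "(y $ 0) \<cdot>\<^sub>v w = 0\<^sub>v n" by (simp add: mult)
    moreover obtain i where "i < n" "w $ i \<noteq> 0" using w by (metis eq_vecI carrier_vecD index_zero_vec)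
    ultimately have "y $ 0 = 0" using w
      by (metis carrier_vecD index_smult_vec(1) index_zero_vec(1) mult_eq_0_iff)
    then show "y = 0\<^sub>v 1" using y by (intro eq_vecI) auto
  qed
  ultimately show ?thesis by (simp add: linear_code_def)
qed

section \<open>Convolution by a multiplicative character\<close>

text \<open>Models \<open>\<phi>\<close> extended by 0, so that sums may run over the whole field.
  The parity of \<open>(r ^ m - 1) div N\<close> will supply \<open>minus_one\<close>, and
  \<open>N > 1\<close> will supply \<open>nontrivial\<close>.\<close>

locale even_mult_character =
  fixes \<psi> :: "'k::finite_field \<Rightarrow> 'f::field"
  assumes zero [simp]: "\<psi> 0 = 0"
    and mult: "\<psi> (a * b) = \<psi> a * \<psi> b"
    and minus_one [simp]: "\<psi> (-1) = 1"
    and nontrivial: "\<exists>c. c \<noteq> 0 \<and> \<psi> c \<noteq> 1"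
begin

lemma one [simp]: "\<psi> 1 = 1"
  using mult[of "-1" "-1"] by simp

lemma minus [simp]: "\<psi> (- a) = \<psi> a"
  using mult[of "-1" a] by simp

lemma eq_0_iff [simp]: "\<psi> a = 0 \<longleftrightarrow> a = 0"
  using mult[of a "inverse a"] by (cases "a = 0") auto

lemma inverse: "\<psi> (inverse a) = inverse (\<psi> a)"
proof (cases "a = 0")
  case False
  then have "\<psi> a * \<psi> (inverse a) = 1" using mult[of a "inverse a"] by simp
  then show ?thesis by (simp add: inverse_unique)
qed simp

text \<open>Scaling the summation index by some \<open>c\<close> with
  \<open>\<psi> c \<noteq> 1\<close> multiplies the sum by \<open>\<psi> c\<close>.\<close>

lemma sum_eq_0: "(\<Sum>a\<in>UNIV. \<psi> a) = 0"
proof -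
  obtain c where c: "c \<noteq> 0" "\<psi> c \<noteq> 1" using nontrivial by blast
  have "(\<Sum>a\<in>UNIV. \<psi> a) = (\<Sum>a\<in>UNIV. \<psi> (c * a))"
    by (rule sum.reindex_bij_witness[of _ "\<lambda>a. c * a" "\<lambda>a. a / c"]) (use c in auto)
  also have "\<dots> = \<psi> c * (\<Sum>a\<in>UNIV. \<psi> a)" by (simp add: mult sum_distrib_left)
  finally show ?thesis using c by simp
qed

text \<open>The operator \<open>Q\<close> on functions on the field, free of the enumeration
  \<open>x\<close>.\<close>

definition conv :: "('k \<Rightarrow> 'f) \<Rightarrow> 'k \<Rightarrow> 'f" where
  "conv f a = (\<Sum>b\<in>UNIV. \<psi> (b - a) * f b)"

lemma conv_const: "conv (\<lambda>_. c) a = 0"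
proof -
  have "(\<Sum>b\<in>UNIV. \<psi> (b - a)) = (\<Sum>b\<in>UNIV. \<psi> b)"
    by (rule sum.reindex_bij_witness[of _ "\<lambda>b. b + a" "\<lambda>b. b - a"]) auto
  then show ?thesis by (simp add: conv_def sum_eq_0 flip: sum_distrib_right)
qed

text \<open>For \<open>a \<noteq> c\<close>, put \<open>b = a + s (c - a)\<close>: the summand becomes \<open>\<psi> (s / (1 - s))\<close>, and
  \<open>s / (1 - s)\<close> runs through everything except \<open>-1\<close>. So the convolutions by \<open>\<psi>\<close> and by its
  inverse compose to \<open>CARD('k)\<close> times the identity minus the all-ones matrix.\<close>

lemma sum_shift_inverse:
  "(\<Sum>b\<in>UNIV. \<psi> (b - a) * inverse (\<psi> (c - b))) = (if a = c then of_nat (CARD('k)) else 0) - 1"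
proof (cases "a = c")
  case True
  have "(\<Sum>b\<in>UNIV. \<psi> (b - a) * inverse (\<psi> (c - b))) = (\<Sum>b\<in>UNIV - {a}. 1)"
  proof (rule sum.mono_neutral_cong_right)
    show "\<forall>b\<in>UNIV - (UNIV - {a}). \<psi> (b - a) * inverse (\<psi> (c - b)) = 0" by auto
    fix b assume "b \<in> UNIV - {a}"
    moreover have "\<psi> (c - b) = \<psi> (b - a)" using minus[of "b - a"] True by simp
    ultimately show "\<psi> (b - a) * inverse (\<psi> (c - b)) = 1" by simp
  qed auto
  then show ?thesis using True by (simp add: of_nat_diff Suc_leI)
next
  case False
  define d where "d = c - a"
  have d: "d \<noteq> 0" using False by (simp add: d_def)
  \<comment> \<open>The term \<open>b = c\<close> drops out because
    \<open>inverse 0 = 0\<close>.\<close>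
  have "(\<Sum>b\<in>UNIV. \<psi> (b - a) * inverse (\<psi> (c - b))) = (\<Sum>b\<in>UNIV - {c}. \<psi> ((b - a) / (c - b)))"
    by (rule sum.mono_neutral_cong_right) (auto simp: divide_inverse mult inverse)
  also have "\<dots> = (\<Sum>s\<in>UNIV - {-1}. \<psi> s)"
  proof (rule sum.reindex_bij_witness[of _ "\<lambda>s. a + d * (s / (1 + s))" "\<lambda>b. (b - a) / (c - b)"])
    fix s assume s: "s \<in> UNIV - {- 1 :: 'k}"
    then have s': "1 + s \<noteq> 0" by (metis DiffE add_eq_0_iff insertI1)
    have eq: "c - (a + d * (s / (1 + s))) = d / (1 + s)"
      using s' by (simp add: d_def field_simps)
    show "(a + d * (s / (1 + s)) - a) / (c - (a + d * (s / (1 + s)))) = s"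
      unfolding eq using s' d by simp
    show "a + d * (s / (1 + s)) \<in> UNIV - {c}" using eq d s' by auto
  next
    fix b assume "b \<in> UNIV - {c}"
    then have b: "c - b \<noteq> 0" by simp
    have eq: "1 + (b - a) / (c - b) = d / (c - b)" using b by (simp add: d_def field_simps)
    show "(b - a) / (c - b) \<in> UNIV - {-1}" using eq b d by auto
    show "a + d * ((b - a) / (c - b) / (1 + (b - a) / (c - b))) = b"
      unfolding eq using b d by simp
  qed simp
  also have "\<dots> = -1" using sum_eq_0 by (simp add: sum_diff1)
  finally show ?thesis using False by simp
qed

text \<open>Convolving \<open>conv f = 0\<close> with the inverse character expresses
  \<open>CARD('k) * f a\<close> as the sum of all values of \<open>f\<close>, which does not depend
  on \<open>a\<close>.\<close>

lemma conv_eq_0_imp_const: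
  assumes card: "of_nat (CARD('k)) \<noteq> (0 :: 'f)" and f: "\<And>a. conv f a = 0"
  shows "f a = f a'"
proof -
  have "of_nat (CARD('k)) * f a = (\<Sum>b\<in>UNIV. f b)" for a
  proof -
    have "0 = (\<Sum>b\<in>UNIV. inverse (\<psi> (a - b)) * conv f b)" by (simp add: f)
    also have "\<dots> = (\<Sum>b\<in>UNIV. \<Sum>c\<in>UNIV. \<psi> (b - c) * inverse (\<psi> (a - b)) * f c)"
      unfolding conv_def sum_distrib_left
    proof (intro sum.cong refl)
      fix b c
      show "inverse (\<psi> (a - b)) * (\<psi> (c - b) * f c) = \<psi> (b - c) * inverse (\<psi> (a - b)) * f c"
        using minus[of "b - c"] by simp
    qed
    also have "\<dots> = (\<Sum>c\<in>UNIV. (\<Sum>b\<in>UNIV. \<psi> (b - c) * inverse (\<psi> (a - b))) * f c)"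
      by (subst sum.swap) (simp add: sum_distrib_right)
    also have "\<dots> = (\<Sum>c\<in>UNIV. (if c = a then of_nat (CARD('k)) * f c else 0) - f c)"
      unfolding sum_shift_inverse by (intro sum.cong) (auto simp: algebra_simps)
    also have "\<dots> = of_nat (CARD('k)) * f a - (\<Sum>b\<in>UNIV. f b)"
      by (simp add: sum_subtractf)
    finally show ?thesis by simp
  qed
  then have "of_nat (CARD('k)) * f a = of_nat (CARD('k)) * f a'" by simp
  then show ?thesis using card by simp
qed

end

text \<open>The dilates \<open>\<lambda>y. e (a * y)\<close> of one nontrivial additive character
  are orthogonal, so inverting the transform recovers \<open>CARD('k) * h x\<close>.\<close>

lemma fourier_injective:
  fixes h :: "'k::finite_field \<Rightarrow> 'l::field"
  assumes e_add: "\<And>x y. e (x + y) = e x * e y" and b: "e b \<noteq> 1"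
    and card: "of_nat (CARD('k)) \<noteq> (0 :: 'l)"
    and hat: "\<And>a. (\<Sum>y\<in>UNIV. h y * e (a * y)) = 0"
    and e0: "e 0 = 1"
  shows "h x = 0"
proof -
  have orth: "(\<Sum>a\<in>UNIV. e (a * y)) = (if y = 0 then of_nat (CARD('k)) else 0)" for y
  proof (cases "y = 0")
    case False
    \<comment> \<open>Translating \<open>a\<close> by \<open>b / y\<close> multiplies the sum by
      \<open>e b \<noteq> 1\<close>, which forces it to vanish.\<close>
    have "(\<Sum>a\<in>UNIV. e (a * y)) = (\<Sum>a\<in>UNIV. e (b + a * y))"
      by (rule sum.reindex_bij_witness[of _ "\<lambda>a. a + b / y" "\<lambda>a. a - b / y"])
        (use False in \<open>auto simp: algebra_simps\<close>)
    also have "\<dots> = e b * (\<Sum>a\<in>UNIV. e (a * y))" by (simp add: e_add sum_distrib_left)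
    finally show ?thesis using False b by simp
  qed (simp add: e0)
  have "0 = (\<Sum>a\<in>UNIV. (\<Sum>y\<in>UNIV. h y * e (a * y)) * e (- (a * x)))" by (simp add: hat)
  also have "\<dots> = (\<Sum>y\<in>UNIV. \<Sum>a\<in>UNIV. h y * e (a * (y - x)))"
  proof (subst sum.swap, unfold sum_distrib_right, intro sum.cong refl)
    fix a y
    show "h y * e (a * y) * e (- (a * x)) = h y * e (a * (y - x))"
      using e_add[of "a * y" "- (a * x)"] by (simp add: right_diff_distrib mult.assoc)
  qed
  also have "\<dots> = (\<Sum>y\<in>UNIV. if y = x then of_nat (CARD('k)) * h x else 0)"
    unfolding sum_distrib_left[symmetric] orth by (intro sum.cong) auto
  also have "\<dots> = of_nat (CARD('k)) * h x" by simp
  finally show ?thesis using card by simp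
qed

text \<open>The Fourier transform turns \<open>conv\<close> into multiplication by the Gauss sum at
  \<open>a\<close>. All factors \<open>c + g\<close> are nonzero, so the transform of
  \<open>h\<close> vanishes. It is taken in the algebraic closure, where the values of
  \<open>e\<close> lie.\<close>

lemma (in even_mult_character) shifted_conv_injective:
  fixes e :: "'k \<Rightarrow> 'f alg_closure"
  assumes e_add: "\<And>x y. e (x + y) = e x * e y" and e0: "e 0 = 1" and b: "e b \<noteq> 1"
    and card: "of_nat (CARD('k)) \<noteq> (0 :: 'f)"
    and c: "c \<noteq> 0"
    and gauss: "\<And>a. a \<noteq> 0 \<Longrightarrow> to_ac c + (\<Sum>s\<in>UNIV. to_ac (\<psi> s) * e (a * s)) \<noteq> 0"
    and h: "\<And>a. c * h a + conv h a = 0"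
  shows "h x = 0"
proof -
  let ?g = "\<lambda>a. \<Sum>s\<in>UNIV. to_ac (\<psi> s) * e (a * s)"
  let ?hat = "\<lambda>a. \<Sum>y\<in>UNIV. to_ac (h y) * e (a * y)"
  have "?hat a = 0" for a
  proof -
    \<comment> \<open>After substituting \<open>z = y + s\<close>, evenness of \<open>\<psi>\<close>
      replaces \<open>\<psi> (- s)\<close> by \<open>\<psi> s\<close>.\<close>
    have inner: "(\<Sum>z\<in>UNIV. to_ac (\<psi> (y - z)) * e (a * z)) = e (a * y) * ?g a" for y
    proof -
      have "(\<Sum>z\<in>UNIV. to_ac (\<psi> (y - z)) * e (a * z))
          = (\<Sum>s\<in>UNIV. to_ac (\<psi> s) * e (a * (y + s)))"
        by (rule sum.reindex_bij_witness[of _ "\<lambda>s. y + s" "\<lambda>z. z - y"])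
          (auto simp: minus[of "_ - y", simplified])
      then show ?thesis by (simp add: distrib_left e_add sum_distrib_left mult_ac)
    qed
    have "0 = (\<Sum>z\<in>UNIV. to_ac (c * h z + conv h z) * e (a * z))" by (simp add: h)
    also have "\<dots> = (\<Sum>z\<in>UNIV. to_ac c * (to_ac (h z) * e (a * z)))
        + (\<Sum>z\<in>UNIV. \<Sum>y\<in>UNIV. to_ac (h y) * (to_ac (\<psi> (y - z)) * e (a * z)))"
      by (simp add: conv_def to_ac_sum sum_distrib_left distrib_left sum.distrib mult_ac)
    also have "\<dots> = to_ac c * ?hat a + (\<Sum>y\<in>UNIV. to_ac (h y) * (e (a * y) * ?g a))"
      by (subst sum.swap) (simp only: inner flip: sum_distrib_left)
    also have "(\<Sum>y\<in>UNIV. to_ac (h y) * (e (a * y) * G)) = G * ?hat a" for G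
      by (simp add: sum_distrib_left mult_ac)
    also have "to_ac c * ?hat a + ?g a * ?hat a = (to_ac c + ?g a) * ?hat a"
      by (simp only: distrib_right)
    finally have "(to_ac c + ?g a) * ?hat a = 0" by simp
    moreover have "to_ac c + ?g a \<noteq> 0"
    proof (cases "a = 0")
      \<comment> \<open>At \<open>a = 0\<close> the Gauss sum degenerates to the sum of
        \<open>\<psi>\<close>, which is 0, and the factor is \<open>c\<close>.\<close>
      case True
      then have "?g a = to_ac (\<Sum>s\<in>UNIV. \<psi> s)" by (simp add: e0 to_ac_sum)
      then show ?thesis using c by (simp add: sum_eq_0)
    qed (rule gauss)
    ultimately show ?thesis by simp
  qed
  moreover have "of_nat (CARD('k)) \<noteq> (0 :: 'f alg_closure)"
    using card by (metis to_ac_of_nat to_ac_eq_0_iff)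
  ultimately have "to_ac (h x) = 0"
    using fourier_injective[of e b "\<lambda>y. to_ac (h y)"] e_add b e0 by blast
  then show ?thesis by simp
qed

section \<open>Characters of a finite field\<close>

lemma finite_field_power_card_minus_1:
  fixes g :: "'k::finite_field"
  assumes "g \<noteq> 0"
  shows "g ^ (CARD('k) - 1) = 1"
proof -
  have "CARD('k) = Suc (CARD('k) - 1)" by simp
  then have "g * g ^ (CARD('k) - 1) = g"
    using finite_field_power_card_eq_same[of g] by (metis power_Suc)
  then show ?thesis using assms by simp
qed

lemma power_mod_eq:
  fixes g :: "'a::monoid_mult"
  assumes "g ^ m = 1"
  shows "g ^ (k mod m) = g ^ k"
proof -
  have "g ^ k = g ^ (m * (k div m) + k mod m)" by simp
  also have "\<dots> = g ^ (k mod m)" unfolding power_add power_mult assms by simp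
  finally show ?thesis by simp
qed

lemma card_minus_1_pos: "CARD('k::finite_field) - 1 > 0"
proof -
  have "card {0, 1 :: 'k} \<le> CARD('k)" by (rule card_mono) simp_all
  moreover have "card {0, 1 :: 'k} = 2" by simp
  ultimately show ?thesis by linarith
qed

section \<open>Powers of a primitive element\<close>

lemma primitive_element_nonzero:
  assumes "primitive_element K g"
  shows "g \<noteq> 0"
proof -
  have "g ^ 1 \<in> K - {0}" using assms unfolding primitive_element_def by blast
  then show ?thesis by simp
qed

lemma primitive_element_bij_betw:
  fixes g :: "'k::finite_field"
  assumes g: "primitive_element UNIV g"
  shows "bij_betw (\<lambda>k. g ^ k) {..<CARD('k) - 1} (UNIV - {0})"
proof -
  let ?m = "CARD('k) - 1"
  have one: "g ^ ?m = 1"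
    by (rule finite_field_power_card_minus_1[OF primitive_element_nonzero[OF g]])
  have "g ^ k \<in> (\<lambda>k. g ^ k) ` {..<?m}" for k
    using power_mod_eq[OF one, of k] card_minus_1_pos[where 'k = 'k]
    by (intro image_eqI[of _ _ "k mod ?m"]) simp_all
  then have "range (\<lambda>k. g ^ k) = (\<lambda>k. g ^ k) ` {..<?m}" by (intro equalityI) (auto simp: image_subset_iff)
  then have image: "(\<lambda>k. g ^ k) ` {..<?m} = UNIV - {0}"
    using g by (simp add: primitive_element_def)
  \<comment> \<open>The map sends \<open>CARD('k) - 1\<close> exponents onto equally many field
    elements, hence is injective.\<close>
  have "inj_on (\<lambda>k. g ^ k) {..<?m}"
    by (rule eq_card_imp_inj_on) (simp_all only: image, simp_all add: card_Diff_singleton)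
  with image show ?thesis by (simp add: bij_betw_def)
qed

lemma primitive_element_power_neq_1:
  fixes g :: "'k::finite_field"
  assumes "primitive_element UNIV g" "0 < i" "i < CARD('k) - 1"
  shows "g ^ i \<noteq> 1"
proof
  assume "g ^ i = 1"
  then have "g ^ i = g ^ 0" by simp
  then have "i = 0"
    by (rule inj_onD[OF bij_betw_imp_inj_on[OF primitive_element_bij_betw[OF assms(1)]]])
      (use assms(2,3) in auto)
  then show False using assms(2) by simp
qed

text \<open>Serves three times: with divisor \<open>N\<close> for \<open>u\<close>, with 4 for
  \<open>v\<close> and with 2 for \<open>v ^ 2\<close>.\<close>

lemma primitive_element_power_div:
  fixes g :: "'k::finite_field"
  assumes g: "primitive_element UNIV g" and N: "N > 1" "N dvd CARD('k) - 1"
  shows "(g ^ ((CARD('k) - 1) div N)) ^ N = 1" "g ^ ((CARD('k) - 1) div N) \<noteq> 1"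
proof -
  show "(g ^ ((CARD('k) - 1) div N)) ^ N = 1"
    using finite_field_power_card_minus_1[OF primitive_element_nonzero[OF g]] N
    by (simp flip: power_mult)
  show "g ^ ((CARD('k) - 1) div N) \<noteq> 1"
    using N card_minus_1_pos[where 'k = 'k]
    by (intro primitive_element_power_neq_1[OF g]) (auto simp: div_greater_zero_iff intro: dvd_imp_le)
qed

text \<open>The definition picks an exponent at most \<open>CARD('k) - 2\<close>. Reducing
  \<open>k\<close> modulo \<open>CARD('k) - 1\<close> changes neither side, so the rule holds for
  every \<open>k\<close> and multiplicativity becomes addition of exponents.\<close>

lemma mult_char_power:
  fixes \<alpha> :: "'k::finite_field" and u :: "'f::field"
  assumes \<alpha>: "primitive_element UNIV \<alpha>" and u: "u ^ (CARD('k) - 1) = 1"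
  shows "mult_char \<alpha> u (\<alpha> ^ k) = u ^ k"
proof -
  let ?m = "CARD('k) - 1"
  note m = card_minus_1_pos[where 'k = 'k]
  have \<alpha>_mod: "\<alpha> ^ (k mod ?m) = \<alpha> ^ k"
    by (rule power_mod_eq[OF finite_field_power_card_minus_1[OF primitive_element_nonzero[OF \<alpha>]]])
  have "(THE j. j \<le> CARD('k) - 2 \<and> \<alpha> ^ j = \<alpha> ^ k) = k mod ?m"
  proof (rule the_equality)
    have "k mod ?m < ?m" using m by simp
    then show "k mod ?m \<le> CARD('k) - 2 \<and> \<alpha> ^ (k mod ?m) = \<alpha> ^ k"
      using \<alpha>_mod by linarith
    fix j assume j: "j \<le> CARD('k) - 2 \<and> \<alpha> ^ j = \<alpha> ^ k"
    show "j = k mod ?m"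
    proof (rule inj_onD[OF bij_betw_imp_inj_on[OF primitive_element_bij_betw[OF \<alpha>]]])
      show "\<alpha> ^ j = \<alpha> ^ (k mod ?m)" using j \<alpha>_mod by simp
      have "j < ?m" using j m by linarith
      then show "j \<in> {..<?m}" by blast
      show "k mod ?m \<in> {..<?m}" using m by simp
    qed
  qed
  then show ?thesis unfolding mult_char_def using power_mod_eq[OF u] by simp
qed

section \<open>The trace and additive characters\<close>

lemma CHAR_finite_field:
  assumes "prime r" "CARD('k::finite_field) = r ^ m"
  shows "CHAR('k) = r"
proof -
  have "prime CHAR('k)" using CHAR_pos[where 'a = 'k] prime_CHAR_semidom[where 'a = 'k] by simp
  moreover have "CHAR('k) dvd r ^ m" using CHAR_dvd_CARD[where 'a = 'k] assms by simp
  ultimately show ?thesis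
    using assms prime_dvd_power primes_dvd_imp_eq by blast
qed

text \<open>The trace is a root of \<open>X ^ r - X\<close>. The \<open>r\<close> elements
  \<open>of_nat k\<close> with \<open>k < r\<close> are distinct roots, so by the degree bound they
  are all of them.\<close>

lemma field_trace_eq_of_nat:
  fixes x :: "'k::finite_field"
  assumes r: "prime r" and card: "CARD('k) = r ^ m"
  shows "\<exists>!k. k < r \<and> of_nat k = field_trace r m x"
proof -
  have char: "CHAR('k) = r" by (rule CHAR_finite_field[OF assms])
  have "field_trace r m x ^ r = (\<Sum>i<m. (x ^ (r ^ i)) ^ r)"
    unfolding field_trace_def by (rule freshmans_dream_sum) (use char r in auto)
  also have "\<dots> = (\<Sum>i<m. x ^ (r ^ Suc i))" by (simp flip: power_mult add: mult.commute)
  \<comment> \<open>Raising to the power \<open>r\<close> shifts the summands by one place; the new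
    last term \<open>x ^ (r ^ m)\<close> equals the lost first term \<open>x\<close>.\<close>
  also have "\<dots> = field_trace r m x + x ^ (r ^ m) - x"
    unfolding field_trace_def using sum.lessThan_Suc_shift[of "\<lambda>i. x ^ (r ^ i)" m] by simp
  also have "\<dots> = field_trace r m x" using finite_field_power_card_eq_same[of x] card by simp
  finally have fixed: "field_trace r m x ^ r = field_trace r m x" .
  define p where "p = Polynomial.monom 1 r - Polynomial.monom (1 :: 'k) 1"
  have "r > 1" using r prime_gt_1_nat by blast
  then have "coeff p r = 1" by (simp add: p_def)
  then have p: "p \<noteq> 0" by auto
  have "degree p \<le> r"
    unfolding p_def using \<open>r > 1\<close> by (intro degree_diff_le) (auto intro: order_trans[OF degree_monom_le])
  then have roots_card: "card {y. poly p y = 0} \<le> r"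
    using card_poly_roots_bound[OF p] by linarith
  have root: "poly p y = 0 \<longleftrightarrow> y ^ r = y" for y by (simp add: p_def poly_monom)
  have inj: "inj_on (of_nat :: nat \<Rightarrow> 'k) {..<r}"
    by (auto intro!: inj_onI simp: of_nat_eq_iff_cong_CHAR char cong_def)
  \<comment> \<open>Fermat's little theorem, by induction from additivity of the Frobenius
    map.\<close>
  have "(of_nat j :: 'k) ^ r = of_nat j" for j
  proof (induction j)
    case 0
    then show ?case using \<open>r > 1\<close> by simp
  next
    case (Suc j)
    have "(1 + of_nat j :: 'k) ^ r = 1 ^ r + of_nat j ^ r"
      by (rule freshmans_dream) (use char r in auto)
    then show ?case unfolding of_nat_Suc Suc.IH by simp
  qed
  then have sub: "of_nat ` {..<r} \<subseteq> {y. poly p y = 0}" by (auto simp: root)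
  note fin = poly_roots_finite[OF p]
  have "card (of_nat ` {..<r} :: 'k set) = r" unfolding card_image[OF inj] by simp
  with card_mono[OF fin sub] roots_card
  have "card (of_nat ` {..<r} :: 'k set) = card {y. poly p y = 0}" by linarith
  from card_subset_eq[OF fin sub this] have eq: "of_nat ` {..<r} = {y. poly p y = 0}" .
  have "field_trace r m x \<in> of_nat ` {..<r}" unfolding eq using fixed root by simp
  then obtain j where "j < r" "of_nat j = field_trace r m x" by auto
  then show ?thesis
    by (intro ex1I[of _ j]) (auto intro: inj_onD[OF inj])
qed

text \<open>The trace is a nonzero polynomial of degree at most \<open>r ^ (m - 1)\<close>, too
  small for it to vanish on all \<open>r ^ m\<close> elements.\<close>

lemma field_trace_nontrivial:
  assumes r: "prime r" and card: "CARD('k::finite_field) = r ^ m" and m: "m > 0"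
  shows "\<exists>b::'k. field_trace r m b \<noteq> 0"
proof (rule ccontr)
  assume "\<not> ?thesis"
  then have all: "field_trace r m b = 0" for b :: 'k by blast
  define p where "p = (\<Sum>i<m. Polynomial.monom (1 :: 'k) (r ^ i))"
  have r1: "r > 1" using r prime_gt_1_nat by blast
  have "coeff p (r ^ (m - 1)) = (\<Sum>i<m. if i = m - 1 then 1 else 0)"
    unfolding p_def coeff_sum using r1 by (intro sum.cong) (auto simp: power_inject_exp)
  then have p: "p \<noteq> 0" using m by auto
  have "degree p \<le> r ^ (m - 1)"
    unfolding p_def
  proof (intro degree_sum_le)
    fix i assume "i \<in> {..<m}"
    then have "r ^ i \<le> r ^ (m - 1)" using r1 by (intro power_increasing) auto
    then show "degree (Polynomial.monom (1 :: 'k) (r ^ i)) \<le> r ^ (m - 1)"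
      using degree_monom_le order_trans by blast
  qed simp
  also have "\<dots> < r ^ m" using r1 m by (intro power_strict_increasing) auto
  finally have "card {y. poly p y = 0} < CARD('k)"
    using card_poly_roots_bound[OF p] card by linarith
  moreover have "{y. poly p y = 0} = UNIV"
    using all by (auto simp: p_def poly_sum poly_monom field_trace_def)
  ultimately show False by simp
qed

text \<open>The representatives below \<open>r\<close> add only modulo \<open>r\<close>, and
  \<open>\<zeta> ^ r = 1\<close> absorbs the difference.\<close>

lemma additive_char_add:
  fixes a :: "'k::finite_field"
  assumes r: "prime r" and card: "CARD('k) = r ^ m" and \<zeta>: "\<zeta> ^ r = 1"
  shows "additive_char r m \<zeta> a (x + y) = additive_char r m \<zeta> a x * additive_char r m \<zeta> a y"
proof -
  define \<tau> where "\<tau> z = (THE k. k < r \<and> of_nat k = field_trace r m z)" for z :: 'k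
  have \<tau>: "of_nat (\<tau> z) = field_trace r m z" for z
    using theI'[OF field_trace_eq_of_nat[OF r card, of z]] by (simp add: \<tau>_def)
  have char: "CHAR('k) = r" by (rule CHAR_finite_field[OF r card])
  have "field_trace r m (a * x + a * y) = field_trace r m (a * x) + field_trace r m (a * y)"
    unfolding field_trace_def using char r by (simp add: freshmans_dream' sum.distrib)
  then have "of_nat (\<tau> (a * x + a * y)) = (of_nat (\<tau> (a * x) + \<tau> (a * y)) :: 'k)"
    by (simp add: \<tau>)
  then have "\<tau> (a * x + a * y) mod r = (\<tau> (a * x) + \<tau> (a * y)) mod r"
    by (simp only: of_nat_eq_iff_cong_CHAR char cong_def)
  moreover have "\<zeta> ^ j = \<zeta> ^ (j mod r)" for j
    using power_mod_eq[OF \<zeta>] by simp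
  ultimately have "\<zeta> ^ \<tau> (a * x + a * y) = \<zeta> ^ (\<tau> (a * x) + \<tau> (a * y))" by metis
  then show ?thesis
    by (simp add: additive_char_def \<tau>_def distrib_left power_add)
qed

lemma additive_char_nontrivial:
  assumes r: "prime r" and card: "CARD('k::finite_field) = r ^ m" and m: "m > 0"
    and \<zeta>: "\<zeta> ^ r = 1" "\<zeta> \<noteq> 1"
  shows "\<exists>b::'k. additive_char r m \<zeta> 1 b \<noteq> 1"
proof -
  obtain b :: 'k where b: "field_trace r m b \<noteq> 0" using field_trace_nontrivial[OF r card m] by blast
  define k where "k = (THE k. k < r \<and> of_nat k = field_trace r m b)"
  have k: "k < r" "of_nat k = field_trace r m b"
    using theI'[OF field_trace_eq_of_nat[OF r card, of b]] by (simp_all add: k_def)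
  have "k \<noteq> 0" using b k(2) by (metis of_nat_0)
  have "\<not> r dvd k" using k(1) \<open>k \<noteq> 0\<close> nat_dvd_not_less by blast
  then have "gcd k r = 1" using r prime_imp_coprime[of r k] by (simp add: coprime_iff_gcd_eq_1 gcd.commute)
  \<comment> \<open>With this Bezout relation, \<open>\<zeta> ^ k = 1\<close> and
    \<open>\<zeta> ^ r = 1\<close> together would give \<open>\<zeta> = 1\<close>.\<close>
  then obtain c d where cd: "k * c = r * d + 1"
    using bezout_nat[OF \<open>k \<noteq> 0\<close>, of r] by metis
  have "\<zeta> ^ k \<noteq> 1"
  proof
    assume "\<zeta> ^ k = 1"
    then have "\<zeta> ^ (k * c) = 1" by (simp add: power_mult)
    then show False using \<zeta> by (simp add: cd power_add power_mult)
  qed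
  then show ?thesis by (auto simp: additive_char_def k_def)
qed

text \<open>If \<open>\<gamma> ^ d = 1\<close> with \<open>n - 1 = r d\<close>, every nonzero element of the subfield is a \<open>d\<close>-th root
  of unity; but a \<open>d\<close>-th root of a root of \<open>1 + X + \<dots> + X ^ (r - 1)\<close> lies in the subfield.\<close>

lemma primitive_element_ac_subfield_power_neq_1:
  fixes \<gamma> :: "'f::field alg_closure"
  assumes \<gamma>: "primitive_element (ac_subfield n) \<gamma>"
    and n: "n > 1" "r dvd n - 1" and r: "r > 1" and r_neq_0: "of_nat r \<noteq> (0 :: 'f)"
  shows "(\<gamma> ^ ((n - 1) div r)) ^ r = 1" "\<gamma> ^ ((n - 1) div r) \<noteq> 1"
proof -
  define d where "d = (n - 1) div r"
  have d: "d * r = n - 1" using n by (simp add: d_def)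
  then have "d > 0" using n by (cases d) auto
  have mem: "y \<in> ac_subfield n - {0} \<longleftrightarrow> y ^ (n - 1) = 1" for y :: "'f alg_closure"
  proof -
    have "y ^ n = y * y ^ (n - 1)" using n by (cases n) auto
    then show ?thesis using n by (auto simp: ac_subfield_def power_0_left)
  qed
  have range: "ac_subfield n - {0} = range (\<lambda>k. \<gamma> ^ k)"
    using \<gamma> by (simp add: primitive_element_def)
  have "\<gamma> \<in> ac_subfield n - {0}" unfolding range by (metis power_one_right rangeI)
  then have "\<gamma> ^ (n - 1) = 1" using mem by blast
  then show "(\<gamma> ^ ((n - 1) div r)) ^ r = 1" using d by (simp add: d_def flip: power_mult)
  show "\<gamma> ^ ((n - 1) div r) \<noteq> 1"
  proof
    assume "\<gamma> ^ ((n - 1) div r) = 1"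
    then have triv: "\<gamma> ^ d = 1" by (simp add: d_def)
    have "\<exists>z :: 'f alg_closure. (\<Sum>i\<le>r - 1. 1 * z ^ i) = 0"
      by (rule alg_closed) (use r in auto)
    moreover have "{..r - 1} = {..<r}" using r by auto
    ultimately obtain z :: "'f alg_closure" where z: "(\<Sum>i<r. z ^ i) = 0" by auto
    have "z ^ r = 1" using z power_diff_1_eq[of z r] by simp
    obtain y where y: "y ^ d = z" using nth_root_exists[OF \<open>d > 0\<close>] by blast
    then have "y ^ (n - 1) = 1" using \<open>z ^ r = 1\<close> d by (metis power_mult)
    then obtain k where "y = \<gamma> ^ k" using mem range by blast
    then have "z = (\<gamma> ^ d) ^ k" using y by (metis mult.commute power_mult)
    then have "z = 1" using triv by simp
    \<comment> \<open>At \<open>z = 1\<close> the sum \<open>1 + z + \<dots> + z ^ (r - 1)\<close>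
      equals \<open>r\<close>.\<close>
    then have "of_nat r = (0 :: 'f alg_closure)" using z by simp
    then show False using r_neq_0 by (metis to_ac_of_nat to_ac_eq_0_iff)
  qed
qed

section \<open>The hull of the code\<close>

context even_mult_character
begin

context
  fixes x :: "nat \<Rightarrow> 'k" and n :: nat and \<phi> :: "'k \<Rightarrow> 'f"
  assumes bij: "bij_betw x {..<n} UNIV" and \<phi>: "\<And>a. a \<noteq> 0 \<Longrightarrow> \<phi> a = \<psi> a"
begin

lemma char_matrix_carrier: "char_matrix n x \<phi> v \<in> carrier_mat n n"
  by (simp add: char_matrix_def)

text \<open>Since \<open>\<psi> 0 = 0\<close>, one formula covers both cases; it is
  \<open>P = v + Q\<close> entry by entry.\<close>

lemma char_matrix_index:
  assumes "i < n" "j < n"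
  shows "char_matrix n x \<phi> v $$ (i, j) = (if i = j then v else 0) + \<psi> (x j - x i)"
proof (cases "i = j")
  case False
  then have "x j \<noteq> x i" using bij_betw_imp_inj_on[OF bij] assms by (auto dest: inj_onD)
  then show ?thesis using False assms by (simp add: char_matrix_def \<phi>)
qed (use assms in \<open>simp add: char_matrix_def\<close>)

lemma char_matrix_transpose: "(char_matrix n x \<phi> v)\<^sup>T = char_matrix n x \<phi> v"
proof (rule eq_matI)
  fix i j assume "i < dim_row (char_matrix n x \<phi> v)" "j < dim_col (char_matrix n x \<phi> v)"
  then have ij: "i < n" "j < n" by (simp_all add: char_matrix_def)
  have "\<psi> (x i - x j) = \<psi> (x j - x i)" using minus[of "x i - x j"] by simp
  then show "(char_matrix n x \<phi> v)\<^sup>T $$ (i, j) = char_matrix n x \<phi> v $$ (i, j)"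
    using char_matrix_carrier[of v] ij by (auto simp: char_matrix_index)
qed (simp_all add: char_matrix_def)

lemma char_matrix_mult_vec:
  assumes y: "y \<in> carrier_vec n" and f: "\<And>j. j < n \<Longrightarrow> y $ j = f (x j)" and i: "i < n"
  shows "(char_matrix n x \<phi> v *\<^sub>v y) $ i = v * f (x i) + conv f (x i)"
proof -
  have "(char_matrix n x \<phi> v *\<^sub>v y) $ i = (\<Sum>j<n. char_matrix n x \<phi> v $$ (i, j) * y $ j)"
    using char_matrix_carrier[of v] i y by (auto simp add: scalar_prod_def atLeast0LessThan)
  also have "\<dots> = (\<Sum>j<n. (if j = i then v * f (x i) else 0) + \<psi> (x j - x i) * f (x j))"
    using i by (intro sum.cong refl) (auto simp: char_matrix_index f distrib_right)
  also have "\<dots> = v * f (x i) + (\<Sum>j<n. \<psi> (x j - x i) * f (x j))"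
    using i by (simp add: sum.distrib)
  also have "(\<Sum>j<n. \<psi> (x j - x i) * f (x j)) = conv f (x i)"
    unfolding conv_def by (rule sum.reindex_bij_betw[OF bij])
  finally show ?thesis .
qed

lemma char_matrix_kernel_iff:
  assumes v: "v ^ 2 = -1" and card: "of_nat (CARD('k)) \<noteq> (0 :: 'f)"
    and inj: "\<forall>h. (\<forall>a. 2 * v * h a + conv h a = 0) \<longrightarrow> (\<forall>a. h a = 0)"
    and y: "y \<in> carrier_vec n"
  shows "y + char_matrix n x \<phi> v *\<^sub>v (char_matrix n x \<phi> v *\<^sub>v y) = 0\<^sub>v n
    \<longleftrightarrow> (\<exists>c. y = c \<cdot>\<^sub>v vec n (\<lambda>_. 1))"
proof -
  let ?P = "char_matrix n x \<phi> v"
  have inv: "inv_into {..<n} x (x j) = j" if "j < n" for j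
    using bij_betw_imp_inj_on[OF bij] that by simp
  have surj: "\<exists>i<n. a = x i" for a
    using bij_betw_imp_surj_on[OF bij] by (metis UNIV_I imageE lessThan_iff)
  \<comment> \<open>The vector is read as a function on the field, so that \<open>P\<close> acts
    through \<open>conv\<close>.\<close>
  define f where "f a = y $ inv_into {..<n} x a" for a
  have f: "y $ j = f (x j)" if "j < n" for j using that by (simp add: f_def inv)
  have Py: "?P *\<^sub>v y \<in> carrier_vec n" using mult_mat_vec_carrier[OF char_matrix_carrier y] .
  have "(?P *\<^sub>v (?P *\<^sub>v y)) $ i
      = v * (v * f (x i) + conv f (x i)) + conv (\<lambda>a. v * f a + conv f a) (x i)" if "i < n" for i
    by (rule char_matrix_mult_vec[OF Py _ that]) (rule char_matrix_mult_vec[OF y f])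
  moreover have "conv (\<lambda>a. v * f a + conv f a) b = v * conv f b + conv (conv f) b" for b
    unfolding conv_def[of "\<lambda>a. v * f a + conv f a"] conv_def[of f b] conv_def[of "conv f"]
    by (simp only: distrib_left sum.distrib sum_distrib_left mult.left_commute)
  \<comment> \<open>This is \<open>1 + (v + Q)\<^sup>2\<close> applied to \<open>f\<close>. The
    first summand vanishes by \<open>v ^ 2 = -1\<close>, which leaves
    \<open>(2 v + Q) (Q f)\<close>.\<close>
  ultimately have PPy: "(y + ?P *\<^sub>v (?P *\<^sub>v y)) $ i
      = (1 + v ^ 2) * f (x i) + (2 * v * conv f (x i) + conv (conv f) (x i))" if "i < n" for i
    using that carrier_vecD[OF mult_mat_vec_carrier[OF char_matrix_carrier[of v] Py]]
    by (simp add: f[OF that] power2_eq_square algebra_simps del: index_mult_mat_vec dim_mult_mat_vec)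
  have "y + ?P *\<^sub>v (?P *\<^sub>v y) = 0\<^sub>v n
      \<longleftrightarrow> (\<forall>i<n. 2 * v * conv f (x i) + conv (conv f) (x i) = 0)"
  proof -
    have "y + ?P *\<^sub>v (?P *\<^sub>v y) \<in> carrier_vec n"
      by (rule add_carrier_vec[OF y mult_mat_vec_carrier[OF char_matrix_carrier Py]])
    then have "y + ?P *\<^sub>v (?P *\<^sub>v y) = 0\<^sub>v n \<longleftrightarrow> (\<forall>i<n. (y + ?P *\<^sub>v (?P *\<^sub>v y)) $ i = 0)"
      by (metis carrier_vecD eq_vecI index_zero_vec)
    moreover have "(y + ?P *\<^sub>v (?P *\<^sub>v y)) $ i = 2 * v * conv f (x i) + conv (conv f) (x i)"
      if "i < n" for i using PPy[OF that] v by simp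
    ultimately show ?thesis by metis
  qed
  also have "\<dots> \<longleftrightarrow> (\<forall>a. 2 * v * conv f a + conv (conv f) a = 0)"
    using surj by metis
  also have "\<dots> \<longleftrightarrow> (\<forall>a. conv f a = 0)"
  proof
    assume "\<forall>a. 2 * v * conv f a + conv (conv f) a = 0"
    then show "\<forall>a. conv f a = 0" using inj by blast
  next
    assume "\<forall>a. conv f a = 0"
    then have "conv f = (\<lambda>_. 0)" by (intro ext) simp
    then show "\<forall>a. 2 * v * conv f a + conv (conv f) a = 0" by (simp add: conv_const)
  qed
  also have "\<dots> \<longleftrightarrow> (\<exists>c. f = (\<lambda>_. c))"
  proof
    assume "\<forall>a. conv f a = 0"
    then have "f a = f 0" for a by (intro conv_eq_0_imp_const[OF card]) simp
    then show "\<exists>c. f = (\<lambda>_. c)" by (intro exI ext)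
  qed (auto simp: conv_const)
  also have "\<dots> \<longleftrightarrow> (\<exists>c. y = c \<cdot>\<^sub>v vec n (\<lambda>_. 1))"
  proof
    assume "\<exists>c. f = (\<lambda>_. c)"
    then obtain c where "f = (\<lambda>_. c)" ..
    then have "y = c \<cdot>\<^sub>v vec n (\<lambda>_. 1)" using y f by (intro eq_vecI) auto
    then show "\<exists>c. y = c \<cdot>\<^sub>v vec n (\<lambda>_. 1)" ..
  next
    assume "\<exists>c. y = c \<cdot>\<^sub>v vec n (\<lambda>_. 1)"
    then obtain c where c: "y = c \<cdot>\<^sub>v vec n (\<lambda>_. 1)" ..
    have "f a = c" for a
    proof -
      obtain i where i: "i < n" "a = x i" using surj by blast
      have "f a = y $ i" unfolding i(2) using f[OF i(1)] by simp
      also have "\<dots> = c" unfolding c using i(1) by simp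
      finally show ?thesis .
    qed
    then show "\<exists>c. f = (\<lambda>_. c)" by blast
  qed
  finally show ?thesis .
qed

text \<open>The admissible messages are the multiples of the all-ones vector and encoding is linear,
  so the hull is the line through the codeword \<open>?w\<close>.\<close>

lemma code_dim_hull_char_code:
  assumes "v ^ 2 = -1" and "of_nat (CARD('k)) \<noteq> (0 :: 'f)"
    and "\<forall>h. (\<forall>a. 2 * v * h a + conv h a = 0) \<longrightarrow> (\<forall>a. h a = 0)"
    and n: "n > 0"
  shows "code_dim (2 * n) (code_hull (2 * n) (char_code n x \<phi> v)) = 1"
proof -
  let ?P = "char_matrix n x \<phi> v" and ?one = "vec n (\<lambda>_. 1) :: 'f vec"
  let ?w = "?one @\<^sub>v (?P *\<^sub>v ?one)"
  have one: "?one \<in> carrier_vec n" by simp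
  have Pone: "?P *\<^sub>v ?one \<in> carrier_vec n" by (rule mult_mat_vec_carrier[OF char_matrix_carrier one])
  have "code_hull (2 * n) (char_code n x \<phi> v)
      = (\<lambda>y. y @\<^sub>v (?P *\<^sub>v y)) ` {y \<in> carrier_vec n. y + ?P *\<^sub>v (?P *\<^sub>v y) = 0\<^sub>v n}"
    unfolding char_code_def row_space_append_columns_one(1)[OF char_matrix_carrier]
      char_matrix_transpose
    by (rule code_hull_systematic[OF char_matrix_carrier[of v], unfolded char_matrix_transpose])
  also have "{y \<in> carrier_vec n. y + ?P *\<^sub>v (?P *\<^sub>v y) = 0\<^sub>v n} = range (\<lambda>c. c \<cdot>\<^sub>v ?one)"
    using char_matrix_kernel_iff[OF assms(1-3)] by (auto simp: smult_carrier_vec)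
  also have "(\<lambda>y. y @\<^sub>v (?P *\<^sub>v y)) ` range (\<lambda>c. c \<cdot>\<^sub>v ?one) = range (\<lambda>c. c \<cdot>\<^sub>v ?w)"
  proof -
    have "(c \<cdot>\<^sub>v ?one) @\<^sub>v (?P *\<^sub>v (c \<cdot>\<^sub>v ?one)) = c \<cdot>\<^sub>v ?w" for c
      unfolding mult_mat_vec[OF char_matrix_carrier one]
      using Pone by (intro eq_vecI) auto
    then show ?thesis by (simp add: image_image)
  qed
  finally have "code_hull (2 * n) (char_code n x \<phi> v) = range (\<lambda>c. c \<cdot>\<^sub>v ?w)" .
  moreover have "?w \<in> carrier_vec (2 * n)"
    using append_carrier_vec[OF one Pone] by (simp add: mult_2)
  moreover have "?w \<noteq> 0\<^sub>v (2 * n)"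
  proof
    assume "?w = 0\<^sub>v (2 * n)"
    then have "?w $ 0 = 0" using n by simp
    then show False using n Pone by (auto simp: index_append_vec)
  qed
  ultimately show ?thesis by (simp add: code_dim_line)
qed

end

end

theorem theorem5p6:
  fixes r m N p e q t :: nat
    and \<alpha> :: "'k::finite_field"
    and \<beta> u v :: "'f::finite_field"
    and \<gamma> \<zeta> :: "'f alg_closure"
    and x :: "nat \<Rightarrow> 'k"
    and \<phi> :: "'k \<Rightarrow> 'f"
    and C :: "'f vec set"
  assumes "prime r" and "m > 0" and "CARD('k) = r ^ m"
    and "N > 1" and "N dvd r ^ m - 1"
    and "prime p" and "e > 0" and "q = p ^ e" and "CARD('f) = q"
    and "gcd p r = 1" and "N dvd q - 1" and "4 dvd q - 1"
    and "primitive_element UNIV \<alpha>"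
    and "primitive_element UNIV \<beta>"
    and "u = \<beta> ^ ((q - 1) div N)"
    and "v = \<beta> ^ ((q - 1) div 4)"
    and "\<phi> = mult_char \<alpha> u"
    and "t > 0" and "r dvd q ^ t - 1"
    and "primitive_element (ac_subfield (q ^ t)) \<gamma>"
    and "\<zeta> = \<gamma> ^ ((q ^ t - 1) div r)"
    and "bij_betw x {..<r ^ m} UNIV"
    and "C = char_code (r ^ m) x \<phi> v"
    and "even ((r ^ m - 1) div N)"
    and "\<And>a. a \<noteq> 0 \<Longrightarrow> 2 * to_ac v + gauss_sum \<phi> (additive_char r m \<zeta> a) \<noteq> 0"
  shows "linear_code (2 * r ^ m) (r ^ m) C \<and> code_dim (2 * r ^ m) (code_hull (2 * r ^ m) C) = 1"
proof -
  let ?n = "r ^ m"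
  have "r > 1" using \<open>prime r\<close> prime_gt_1_nat by blast
  have charf: "CHAR('f) = p" by (rule CHAR_finite_field) (use assms in auto)
  have "\<not> p dvd r"
    using \<open>gcd p r = 1\<close> \<open>prime p\<close> by (metis gcd_nat.absorb1 not_prime_1)
  \<comment> \<open>Both the inversion of \<open>Q\<close> up to constants and Fourier inversion
    divide by \<open>CARD('k) = r ^ m\<close> in characteristic \<open>p\<close>.\<close>
  then have r0: "of_nat r \<noteq> (0 :: 'f)" by (simp add: of_nat_eq_0_iff_char_dvd charf)
  then have card0: "of_nat (CARD('k)) \<noteq> (0 :: 'f)" by (simp add: \<open>CARD('k) = r ^ m\<close>)

  have ub: "u ^ N = 1" "u \<noteq> 1"
    using primitive_element_power_div[OF \<open>primitive_element UNIV \<beta>\<close> \<open>N > 1\<close>] assms by simp_all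
  have "(v ^ 2) ^ 2 = 1"
    using primitive_element_power_div(1)[OF \<open>primitive_element UNIV \<beta>\<close>, of 4] assms
    by (simp flip: power_mult)
  moreover have "v ^ 2 \<noteq> 1"
  proof -
    have "v ^ 2 = \<beta> ^ ((CARD('f) - 1) div 2)"
    proof -
      have "(q - 1) div 4 * 2 = (q - 1) div 2" using \<open>4 dvd q - 1\<close> by presburger
      then show ?thesis using assms by (simp flip: power_mult)
    qed
    moreover have "2 dvd q - 1" using \<open>4 dvd q - 1\<close> by presburger
    ultimately show ?thesis
      using primitive_element_power_div(2)[OF \<open>primitive_element UNIV \<beta>\<close>, of 2] assms by simp
  qed
  \<comment> \<open>The element \<open>v ^ 2\<close> is a square root of 1 other than 1.\<close>
  ultimately have v: "v ^ 2 = -1" by (metis power2_eq_1_iff)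
  then have "v \<noteq> 0" by auto
  \<comment> \<open>Otherwise 1 and -1 would coincide, against \<open>v ^ 2 = -1\<close> and
    \<open>v ^ 2 \<noteq> 1\<close>.\<close>
  have v2: "2 * v \<noteq> 0"
  proof
    assume "2 * v = 0"
    then have "(1 :: 'f) + 1 = 0" using \<open>v \<noteq> 0\<close> by simp
    then have "- 1 = (1 :: 'f)" by (simp only: neg_eq_iff_add_eq_0)
    then show False using v \<open>v ^ 2 \<noteq> 1\<close> by simp
  qed

  have nN: "?n - 1 = N * ((?n - 1) div N)" using \<open>N dvd r ^ m - 1\<close> by simp
  have "u ^ (N * ((?n - 1) div N)) = 1" by (simp only: power_mult ub power_one)
  then have un: "u ^ (CARD('k) - 1) = 1" using nN \<open>CARD('k) = r ^ m\<close> by metis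
  have \<phi>: "\<phi> (\<alpha> ^ k) = u ^ k" for k
    unfolding \<open>\<phi> = mult_char \<alpha> u\<close> by (rule mult_char_power[OF \<open>primitive_element UNIV \<alpha>\<close> un])
  have log: "\<exists>k. a = \<alpha> ^ k" if "a \<noteq> 0" for a
    using \<open>primitive_element UNIV \<alpha>\<close> that unfolding primitive_element_def by blast
  have \<alpha>0: "\<alpha> \<noteq> 0" by (rule primitive_element_nonzero) fact

  define \<psi> where "\<psi> a = (if a = 0 then 0 else \<phi> a)" for a
  have \<psi>: "\<psi> (\<alpha> ^ k) = u ^ k" for k by (simp add: \<psi>_def \<alpha>0 \<phi>)
  interpret even_mult_character \<psi>
  proof
    show "\<psi> 0 = 0" by (simp add: \<psi>_def)
    show "\<psi> (a * b) = \<psi> a * \<psi> b" for a b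
    proof (cases "a = 0 \<or> b = 0")
      case False
      then obtain i j where "a = \<alpha> ^ i" "b = \<alpha> ^ j" using log by metis
      then show ?thesis using \<psi>[of "i + j"] by (simp add: power_add \<psi>)
    qed (auto simp: \<psi>_def)
    have "\<psi> \<alpha> \<noteq> 1" using ub \<psi>[of 1] by simp
    then show "\<exists>c. c \<noteq> 0 \<and> \<psi> c \<noteq> 1" using \<alpha>0 by auto
    \<comment> \<open>Then \<open>\<alpha> ^ (N * s)\<close> is a square root of 1 other than 1,
      hence -1, and its image \<open>u ^ (N * s)\<close> is 1.\<close>
    obtain s where s: "(?n - 1) div N = 2 * s" using \<open>even ((?n - 1) div N)\<close> by (rule evenE)
    then have n1: "CARD('k) - 1 = N * s * 2" using nN assms by simp
    have "N * s > 0" using card_minus_1_pos[where 'k = 'k] n1 by linarith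
    have "\<alpha> ^ (N * s) \<noteq> 1"
      by (rule primitive_element_power_neq_1[OF \<open>primitive_element UNIV \<alpha>\<close>])
        (use \<open>N * s > 0\<close> n1 in linarith)+
    moreover have "(\<alpha> ^ (N * s)) ^ 2 = 1"
      using finite_field_power_card_minus_1[OF \<alpha>0] unfolding n1 by (simp only: power_mult)
    ultimately have "\<alpha> ^ (N * s) = -1" using power2_eq_1_iff by blast
    then have "\<psi> (-1) = u ^ (N * s)" by (metis \<psi>)
    also have "\<dots> = 1" by (simp add: power_mult ub)
    finally show "\<psi> (-1) = 1" .
  qed

  have "q > 1" using assms by (metis one_less_power prime_gt_1_nat)
  then have qt: "q ^ t > 1" using \<open>t > 0\<close> by (rule one_less_power)
  note \<zeta> = primitive_element_ac_subfield_power_neq_1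
    [OF \<open>primitive_element (ac_subfield (q ^ t)) \<gamma>\<close> qt \<open>r dvd q ^ t - 1\<close> \<open>r > 1\<close> r0,
     folded \<open>\<zeta> = \<gamma> ^ ((q ^ t - 1) div r)\<close>]
  \<comment> \<open>One character suffices, as \<open>\<chi>\<^sub>a\<close> is its dilate by
    \<open>a\<close>.\<close>
  define \<chi> :: "'k \<Rightarrow> 'f alg_closure" where "\<chi> = additive_char r m \<zeta> 1"
  have \<chi>_add: "\<chi> (y + z) = \<chi> y * \<chi> z" for y z
    unfolding \<chi>_def by (rule additive_char_add) (use assms \<zeta> in auto)
  have \<chi>_nontriv: "\<exists>b. \<chi> b \<noteq> 1"
    unfolding \<chi>_def by (rule additive_char_nontrivial) (use assms \<zeta> in auto)
  \<comment> \<open>As a power of \<open>\<zeta>\<close>, \<open>\<chi> 0\<close> is nonzero;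
    additivity gives \<open>\<chi> 0 = \<chi> 0 * \<chi> 0\<close>, so it is 1.\<close>
  have "\<zeta> \<noteq> 0" using \<zeta> \<open>r > 1\<close> by (auto simp: power_0_left)
  then have "\<chi> 0 \<noteq> 0" by (simp add: \<chi>_def additive_char_def)
  then have \<chi>_0: "\<chi> 0 = 1" using \<chi>_add[of 0 0] by simp
  have gauss: "to_ac (2 * v) + (\<Sum>s\<in>UNIV. to_ac (\<psi> s) * \<chi> (a * s)) \<noteq> 0" if "a \<noteq> 0" for a
  proof -
    have "(\<Sum>s\<in>UNIV. to_ac (\<psi> s) * \<chi> (a * s)) = gauss_sum \<phi> (additive_char r m \<zeta> a)"
      unfolding gauss_sum_def
      by (rule sum.mono_neutral_cong_right) (auto simp: \<psi>_def \<chi>_def additive_char_def)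
    then show ?thesis using assms(25)[OF that] by simp
  qed
  have "\<forall>h. (\<forall>a. 2 * v * h a + conv h a = 0) \<longrightarrow> (\<forall>a. h a = 0)"
    using \<chi>_nontriv shifted_conv_injective[OF \<chi>_add \<chi>_0 _ card0 v2 gauss] by blast
  moreover have "?n > 0" using \<open>r > 1\<close> by simp
  ultimately have "code_dim (2 * ?n) (code_hull (2 * ?n) (char_code ?n x \<phi> v)) = 1"
    using code_dim_hull_char_code[OF \<open>bij_betw x {..<r ^ m} UNIV\<close> _ v card0, of \<phi>]
    by (simp add: \<psi>_def)
  moreover have "linear_code (2 * ?n) ?n C"
    unfolding \<open>C = _\<close> char_code_def
    by (rule row_space_append_columns_one(2)) (simp add: char_matrix_def)
  ultimately show ?thesis using \<open>C = _\<close> by simp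
qed

end
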